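(* Let $M=\{\mu_1^{(f(\mu_1))},\ldots,\mu_r^{(f(\mu_r))}\}$ be a multiset of umbral monomials of length $|M|=k$, and let $n$ be an integer with $n>k$. Then $$(\chi\boldsymbol{.}\mu)_M\simeq\sum_{\pi\in\Pi_k}\frac{(\chi\boldsymbol{.}\chi)^{|\pi|}}{(n)_{|\pi|}}\sum_{\tau\in\Pi_{|\pi|}}(\chi\boldsymbol{.}\chi)^{\boldsymbol{.}\tau}\,(n\boldsymbol{.}\mu)_{S_\tau},$$ where $S_\tau$ is the subdivision of $M$ corresponding to the partition $\tau$ of the set built with the blocks of $\pi$.
   Context: Umbral calculus: $K$ is a field of characteristic zero, $A$ a set of symbols called umbrae, $E:K[A]\to K$ a linear functional with $E[1]=1$ and $E[\alpha^i\beta^j\cdots\gamma^k]=E[\alpha^i]E[\beta^j]\cdots E[\gamma^k]$ for distinct umbrae. For umbral polynomials, $p\simeq q$ means $E[p]=E[q]$; $p,q$ are uncorrelated if no umbra occurs in both; $p\equiv q$ (similar) means $E[p^j]=E[q^j]$ for all $j\ge0$. The alphabet is saturated: for every sequence $1,a_1,a_2,\dots$ in $K$ there are infinitely many umbrae with these moments, and auxiliary umbrae are treated as elements of $A$. $(x)_m=x(x-1)\cdots(x-m+1)$; $\Pi_k$ is the set of partitions of $[k]=\{1,\dots,k\}$ (or of any $k$-element set); $|\pi|$ is the number of blocks of $\pi$. In a multiset, $\mu^{(f)}$ means $\mu$ with multiplicity $f$; $|M|$ is the sum of multiplicities. Dot products: for an umbral polynomial $p$, $n\boldsymbol{.}p$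 denotes $p_1+\cdots+p_n$, where $p_j$ is obtained from $p$ by replacing each umbra by its $j$th copy (copies being similar to the original and mutually uncorrelated); the same copies are used for all $p$, so $p_j$ is correlated with $q_j$ if $p,q$ are, but uncorrelated with $q_l$ for $l\ne j$. The singleton umbra $\chi$ has $E[\chi]=1$, $E[\chi^j]=0$ for $j\ge2$; it does not occur in the $\mu_i$. One has $E[(\chi)_m]=(-1)^{m-1}(m-1)!$, and $\chi\boldsymbol{.}\chi$ is an umbra with $E[(\chi\boldsymbol{.}\chi)^m]=(-1)^{m-1}(m-1)!$ for $m\ge1$. $(n\boldsymbol{.}\mu)_M=\prod_i(n\boldsymbol{.}\mu_i)^{f(\mu_i)}$ and $(\chi\boldsymbol{.}\mu)_M=\prod_i(\chi\boldsymbol{.}\mu_i)^{f(\mu_i)}$. The evaluation of the latter (the multivariate cumulant of $M$) is given by symbolic substitution: $q_M(n)=E[(n\boldsymbol{.}\mu)_M]$ is a polynomial in $n$, and $E[(\chi\boldsymbol{.}\mu)_M]=E[q_M(\chi)]$. (For $M=\{\alpha^{(k)}\}$ this is the ordinary $k$th cumulant of $\alpha$.) For a partition $\tau$, $(\chi\boldsymbol{.}\chi)^{\boldsymbol{.}\tau}$ is a product, over the blocks $C$ of $\tau$, of $|C|$th powers of uncorrelated umbrae similar to $\chi\boldsymbol{.}\chi$, so $E[(\chi\boldsymbol{.}\chi)^{\boldsymbol{.}\tau}]=\prod_{C\in\tau}(-1)^{|C|-1}(|C|-1)!$. The factors $(\chi\boldsymbol{.}\chi)^{|\pi|}$, $(\chi\boldsymbol{.}\chi)^{\boldsymbol{.}\tau}$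 and $(n\boldsymbol{.}\mu)_{S_\tau}$ are mutually uncorrelated. Subdivisions: fix $s:[k]\to\{\mu_1,\dots,\mu_r\}$ with $|s^{-1}(\mu_i)|=f(\mu_i)$. If $\pi\in\Pi_k$ and $\tau$ is a partition of the set of blocks of $\pi$, $S_\tau$ is the multiset of the submultisets $\{s(j): j\in\bigcup_{B\in C}B\}$, $C\in\tau$, and $(n\boldsymbol{.}\mu)_{S_\tau}=\prod_{C\in\tau}n\boldsymbol{.}\bigl(\prod_{B\in C}\prod_{j\in B}s(j)\bigr)$. *)

theory Defs
  imports
    "HOL-Library.Poly_Mapping"
    "HOL-Library.Multiset"
    "HOL-Library.Disjoint_Sets"
    "HOL-Computational_Algebra.Polynomial"
begin

text \<open>
  The polynomial ring $K[A]$: the alphabet $A$ is the type \<open>'a\<close>, a power product is a finitely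
  supported exponent function, and a polynomial is a finitely supported coefficient function on
  power products. Multiplication in the library is convolution.
\<close>

type_synonym ('a, 'k) umbral_poly = "('a \<Rightarrow>\<^sub>0 nat) \<Rightarrow>\<^sub>0 'k"

definition umb :: "'a \<Rightarrow> ('a, 'k::comm_ring_1) umbral_poly" where
  "umb \<alpha> = Poly_Mapping.single (Poly_Mapping.single \<alpha> 1) 1"

definition scal :: "'k \<Rightarrow> ('a, 'k::comm_ring_1) umbral_poly" where
  "scal c = Poly_Mapping.single 0 c"

text \<open>A nonzero scalar coefficient is allowed.\<close>

definition umbral_monomial :: "('a, 'k::comm_ring_1) umbral_poly \<Rightarrow> bool" where
  "umbral_monomial p \<longleftrightarrow> (\<exists>t c. c \<noteq> 0 \<and> p = Poly_Mapping.single t c)"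

definition umbrae :: "('a, 'k::comm_ring_1) umbral_poly \<Rightarrow> 'a set" where
  "umbrae p = (\<Union>t\<in>Poly_Mapping.keys p. Poly_Mapping.keys t)"

definition uncorrelated :: "('a, 'k::comm_ring_1) umbral_poly \<Rightarrow> ('a, 'k) umbral_poly \<Rightarrow> bool" where
  "uncorrelated p q \<longleftrightarrow> umbrae p \<inter> umbrae q = {}"

locale umbral_calculus =
  fixes E :: "('a, 'k::field_char_0) umbral_poly \<Rightarrow> 'k"
  assumes E_add: "E (p + q) = E p + E q"
    and E_scal: "E (scal c * p) = c * E p"
    and E_one: "E 1 = 1"
    and E_power_product:
      "finite F \<Longrightarrow> E (\<Prod>\<alpha>\<in>F. umb \<alpha> ^ i \<alpha>) = (\<Prod>\<alpha>\<in>F. E (umb \<alpha> ^ i \<alpha>))"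
    and saturated: "a 0 = 1 \<Longrightarrow> infinite {\<alpha>. \<forall>j. E (umb \<alpha> ^ j) = a j}"

definition umb_equiv ::
  "(('a, 'k::comm_ring_1) umbral_poly \<Rightarrow> 'k) \<Rightarrow> ('a, 'k) umbral_poly \<Rightarrow> ('a, 'k) umbral_poly \<Rightarrow> bool"
  where "umb_equiv E p q \<longleftrightarrow> E p = E q"

definition similar ::
  "(('a, 'k::comm_ring_1) umbral_poly \<Rightarrow> 'k) \<Rightarrow> ('a, 'k) umbral_poly \<Rightarrow> ('a, 'k) umbral_poly \<Rightarrow> bool"
  where "similar E p q \<longleftrightarrow> (\<forall>j. E (p ^ j) = E (q ^ j))"

text \<open>
  \<open>copy j \<alpha>\<close> is the \<open>j\<close>th copy of the umbra \<open>\<alpha>\<close>. Distinct umbrae are uncorrelated, so mutual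
  uncorrelation of the copies is injectivity in the pair \<open>(j, \<alpha>)\<close>.
\<close>

definition umbral_copies ::
  "(('a, 'k::comm_ring_1) umbral_poly \<Rightarrow> 'k) \<Rightarrow> (nat \<Rightarrow> 'a \<Rightarrow> 'a) \<Rightarrow> bool" where
  "umbral_copies E copy \<longleftrightarrow>
     inj (\<lambda>(j, \<alpha>). copy j \<alpha>) \<and> (\<forall>j \<alpha>. similar E (umb (copy j \<alpha>)) (umb \<alpha>))"

definition replace_umbrae :: "('a \<Rightarrow> 'a) \<Rightarrow> ('a, 'k::comm_ring_1) umbral_poly \<Rightarrow> ('a, 'k) umbral_poly"
  where "replace_umbrae h p =
    (\<Sum>t\<in>Poly_Mapping.keys p. scal (Poly_Mapping.lookup p t) *
       (\<Prod>\<alpha>\<in>Poly_Mapping.keys t. umb (h \<alpha>) ^ Poly_Mapping.lookup t \<alpha>))"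

definition dot ::
  "(nat \<Rightarrow> 'a \<Rightarrow> 'a) \<Rightarrow> nat \<Rightarrow> ('a, 'k::comm_ring_1) umbral_poly \<Rightarrow> ('a, 'k) umbral_poly" where
  "dot copy n p = (\<Sum>j = 1..n. replace_umbrae (copy j) p)"

definition dot_mset ::
  "(nat \<Rightarrow> 'a \<Rightarrow> 'a) \<Rightarrow> nat \<Rightarrow> ('a, 'k::comm_ring_1) umbral_poly multiset \<Rightarrow> ('a, 'k) umbral_poly" where
  "dot_mset copy n M = (\<Prod>\<mu>\<in>set_mset M. dot copy n \<mu> ^ count M \<mu>)"

text \<open>The polynomial $q_M$ with $q_M(n) = E[(n.\mu)_M]$; it is unique in characteristic zero.\<close>

definition dot_poly ::
  "(('a, 'k::field_char_0) umbral_poly \<Rightarrow> 'k) \<Rightarrow> (nat \<Rightarrow> 'a \<Rightarrow> 'a) \<Rightarrow>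
     ('a, 'k) umbral_poly multiset \<Rightarrow> 'k poly" where
  "dot_poly E copy M = (THE q. \<forall>n. poly q (of_nat n) = E (dot_mset copy n M))"

definition singleton_umbra :: "(('a, 'k::comm_ring_1) umbral_poly \<Rightarrow> 'k) \<Rightarrow> 'a \<Rightarrow> bool" where
  "singleton_umbra E \<chi> \<longleftrightarrow> E (umb \<chi>) = 1 \<and> (\<forall>j\<ge>2. E (umb \<chi> ^ j) = 0)"

text \<open>
  $(\chi.\mu)_M$ is only determined by its evaluation, which symbolic substitution defines to be
  $E[q_M(\chi)]$; it is represented by the umbral polynomial $q_M(\chi)$.
\<close>

definition chi_dot_mset ::
  "(('a, 'k::field_char_0) umbral_poly \<Rightarrow> 'k) \<Rightarrow> (nat \<Rightarrow> 'a \<Rightarrow> 'a) \<Rightarrow> 'a \<Rightarrow>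
     ('a, 'k) umbral_poly multiset \<Rightarrow> ('a, 'k) umbral_poly" where
  "chi_dot_mset E copy \<chi> M = poly (map_poly scal (dot_poly E copy M)) (umb \<chi>)"

text \<open>
  \<open>\<kappa>\<close> is an umbra $\chi.\chi$: its \<open>m\<close>th moment is the evaluation of $(\chi.\chi)^m$, the case
  $M = \{\chi^{(m)}\}$ of the preceding definition.
\<close>

definition chi_dot_chi_umbra ::
  "(('a, 'k::field_char_0) umbral_poly \<Rightarrow> 'k) \<Rightarrow> (nat \<Rightarrow> 'a \<Rightarrow> 'a) \<Rightarrow> 'a \<Rightarrow> 'a \<Rightarrow> bool" where
  "chi_dot_chi_umbra E copy \<chi> \<kappa> \<longleftrightarrow>
     (\<forall>m. E (umb \<kappa> ^ m) = E (chi_dot_mset E copy \<chi> (replicate_mset m (umb \<chi>))))"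

text \<open>$\kappa^{.\tau}$, where \<open>\<kappa>s C\<close> is the umbra attached to the block \<open>C\<close>.\<close>

definition dot_power_partition :: "('b set \<Rightarrow> 'a) \<Rightarrow> 'b set set \<Rightarrow> ('a, 'k::comm_ring_1) umbral_poly" where
  "dot_power_partition \<kappa>s \<tau> = (\<Prod>C\<in>\<tau>. umb (\<kappa>s C) ^ card C)"

definition falling :: "'k::comm_ring_1 \<Rightarrow> nat \<Rightarrow> 'k" where
  "falling x m = (\<Prod>i<m. x - of_nat i)"

text \<open>The subdivision $S_\tau$ as a multiset of submultisets, and $(n.\mu)_{S}$.\<close>

definition subdivision :: "('i \<Rightarrow> 'b) \<Rightarrow> 'i set set set \<Rightarrow> 'b multiset multiset" where
  "subdivision s \<tau> = image_mset (\<lambda>C. image_mset s (mset_set (\<Union>C))) (mset_set \<tau>)"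

definition dot_subdivision ::
  "(nat \<Rightarrow> 'a \<Rightarrow> 'a) \<Rightarrow> nat \<Rightarrow> ('a, 'k::comm_ring_1) umbral_poly multiset multiset \<Rightarrow>
     ('a, 'k) umbral_poly" where
  "dot_subdivision copy n S = (\<Prod>N\<in>#S. dot copy n (\<Prod>\<mu>\<in>#N. \<mu>))"

end

theory Submission
  imports Defs
begin

text \<open>
  Write $m(B) = E[\prod_{i \in B} s(i)]$ for a block $B$. Both sides evaluate to
  $\sum_\pi c_{|\pi|} \prod_{B \in \pi} m(B)$ with $c_0 = 1$ and
  $c_m = (-1)^{m-1}(m-1)!$ for $m \ge 1$, summand by summand in \<open>\<pi>\<close>. Both evaluations use the sum over all injections $f : P \to \{1,\ldots,n\}$ of
  $\prod_{b \in P} x_{b, f(b)}$ (\<open>injective_sum\<close>).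

  If $x_{b,j}$ is the $j$th copy of a polynomial $p_b$, the factors along an injection are
  uncorrelated, so this sum evaluates to $(n)_{|P|} \prod_b E[p_b]$ (\<open>E_injective_sum_copies\<close>).

  Left-hand side: expanding $(n.\mu)_M$ and sorting the functions $\{1,\ldots,k\} \to \{1,\ldots,n\}$ by
  their fibres writes it as a sum over \<open>\<pi>\<close> of injective sums
  (\<open>prod_sum_eq_partition_injective_sums\<close>). Hence
  $q_M(n) = \sum_\pi (n)_{|\pi|} \prod_{B \in \pi} m(B)$, and substituting $\chi$ for $n$ turns
  $(n)_{|\pi|}$ into the sum of the coefficients of degree 0 and 1 of the falling factorial, which
  is $c_{|\pi|}$ (\<open>low_coeffs_falling\<close>). The same expansion for a power of $\chi$ shows that the
  moments of $\chi.\chi$ are the $c_m$ (\<open>moments_chi_dot_chi\<close>).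

  Right-hand side: for fixed \<open>\<pi>\<close>, the factor $(n.\mu)_{S_\tau}$ is a product of power sums in the
  copies of the block monomials, and the coefficients $\prod_{C \in \tau} c_{|C|}$ are exactly those
  that express an injective sum by power sums (\<open>injective_sum_eq_power_sums\<close>). The inner sum
  therefore evaluates to $(n)_{|\pi|} \prod_{B \in \pi} m(B)$, which cancels the denominator.
\<close>

section \<open>Adding an element to a partitioned set\<close>

lemma card_partition_on_le:
  assumes "finite A" "partition_on A \<pi>"
  shows "card \<pi> \<le> card A"
proof -
  have "\<exists>x. x \<in> B" if "B \<in> \<pi>" for B
    using that partition_onD3[OF assms(2)] by (metis ex_in_conv)
  then obtain x where x: "\<And>B. B \<in> \<pi> \<Longrightarrow> x B \<in> B" by metis
  have "inj_on x \<pi>"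
    using x disjointD[OF partition_onD2[OF assms(2)]] by (metis disjoint_iff inj_onI)
  moreover have "x ` \<pi> \<subseteq> A" using x partition_onD1[OF assms(2)] by blast
  ultimately show ?thesis using assms(1) by (rule card_inj_on_le)
qed

lemma partition_on_insert_singleton:
  assumes "partition_on A \<pi>" "b \<notin> A"
  shows "partition_on (insert b A) (insert {b} \<pi>)"
  using assms unfolding partition_on_def
  by (auto simp: pairwise_insert disjnt_def)

lemma partition_on_insert_into_block:
  assumes "partition_on A \<pi>" "C \<in> \<pi>" "b \<notin> A"
  shows "partition_on (insert b A) (insert (insert b C) (\<pi> - {C}))"
proof (rule partition_onI)
  show "\<Union>(insert (insert b C) (\<pi> - {C})) = insert b A"
    using assms unfolding partition_on_def by auto
  show "{} \<notin> insert (insert b C) (\<pi> - {C})"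
    using assms unfolding partition_on_def by auto
  have "disjoint \<pi>" "\<And>D. D \<in> \<pi> \<Longrightarrow> b \<notin> D"
    using assms unfolding partition_on_def by auto
  then show "disjnt p q" if "p \<in> insert (insert b C) (\<pi> - {C})"
    "q \<in> insert (insert b C) (\<pi> - {C})" "p \<noteq> q" for p q
    using that assms(2) unfolding pairwise_def disjnt_def by auto
qed

text \<open>
  Each partition of \<open>insert b A\<close> arises in exactly one way from a partition of \<open>A\<close>: either \<open>b\<close> forms
  a block of its own, or \<open>b\<close> joins an existing block. Both partition expansions of the next section
  are proved by induction with this recursion.
\<close>

lemma sum_partitions_insert:
  fixes G :: "'a set set \<Rightarrow> 'r::comm_monoid_add"
  assumes fin: "finite A" and b: "b \<notin> A"
  shows "(\<Sum>\<sigma> | partition_on (insert b A) \<sigma>. G \<sigma>) =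
    (\<Sum>\<pi> | partition_on A \<pi>. G (insert {b} \<pi>) + (\<Sum>C\<in>\<pi>. G (insert (insert b C) (\<pi> - {C}))))"
proof -
  \<comment> \<open>For a partition with \<open>b\<close> in its union this is the block that contains \<open>b\<close>.\<close>
  define blk where "blk \<sigma> = \<Union>{D\<in>\<sigma>. b \<in> D}" for \<sigma>
  have finp: "finite {\<sigma>. partition_on A' \<sigma>}" if "finite A'" for A' :: "'a set"
    using finitely_many_partition_on[OF that] .
  have blk: "blk \<sigma> = D" if "partition_on (insert b A) \<sigma>" "D \<in> \<sigma>" "b \<in> D" for \<sigma> D
  proof -
    have "{D\<in>\<sigma>. b \<in> D} = {D}"
      using that unfolding partition_on_def pairwise_def disjnt_def by blast
    then show ?thesis by (simp add: blk_def)
  qed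
  have ex: "\<exists>D\<in>\<sigma>. b \<in> D" if "partition_on (insert b A) \<sigma>" for \<sigma>
    using partition_onD1[OF that] by auto
  have notb: "b \<notin> D" if "partition_on A \<pi>" "D \<in> \<pi>" for \<pi> D
    using that b partition_onD1[OF that(1)] by auto
  have single: "(\<Sum>\<sigma> | partition_on (insert b A) \<sigma> \<and> {b} \<in> \<sigma>. G \<sigma>)
      = (\<Sum>\<pi> | partition_on A \<pi>. G (insert {b} \<pi>))"
  proof (rule sum.reindex_bij_witness[where i = "insert {b}" and j = "\<lambda>\<sigma>. \<sigma> - {{b}}"])
    fix \<sigma> assume "\<sigma> \<in> {\<sigma>. partition_on (insert b A) \<sigma> \<and> {b} \<in> \<sigma>}"
    then have s: "partition_on (insert b A) \<sigma>" "{b} \<in> \<sigma>" by auto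
    show i: "insert {b} (\<sigma> - {{b}}) = \<sigma>" using s by auto
    have "blk \<sigma> = {b}" using blk[OF s] by simp
    then have "b \<notin> D" if "D \<in> \<sigma> - {{b}}" for D
      using blk[OF s(1), of D] that by blast
    then have "disjnt {b} (\<Union>(\<sigma> - {{b}}))" by (auto simp: disjnt_def)
    then have "partition_on (insert b A - {b}) (\<sigma> - {{b}})"
      using partition_on_insert[of "{b}" "\<sigma> - {{b}}" "insert b A"] s i by simp
    then show "\<sigma> - {{b}} \<in> {\<pi>. partition_on A \<pi>}" using b by simp
    show "G (insert {b} (\<sigma> - {{b}})) = G \<sigma>" using i by simp
  next
    fix \<pi> assume "\<pi> \<in> {\<pi>. partition_on A \<pi>}"
    then have p: "partition_on A \<pi>" by simp
    then have "{b} \<notin> \<pi>" using b partition_onD1[OF p] by auto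
    then show "insert {b} \<pi> - {{b}} = \<pi>" by auto
    show "insert {b} \<pi> \<in> {\<sigma>. partition_on (insert b A) \<sigma> \<and> {b} \<in> \<sigma>}"
      using partition_on_insert_singleton[OF p b] by simp
  qed
  \<comment> \<open>Inverse to enlarging the block \<open>C\<close>: remove \<open>b\<close> from its block and remember which block it was.\<close>
  have into: "(\<Sum>\<sigma> | partition_on (insert b A) \<sigma> \<and> {b} \<notin> \<sigma>. G \<sigma>)
      = (\<Sum>(\<pi>, C)\<in>(SIGMA \<pi>:{\<pi>. partition_on A \<pi>}. \<pi>). G (insert (insert b C) (\<pi> - {C})))"
  proof (rule sum.reindex_bij_witness[where i = "\<lambda>(\<pi>, C). insert (insert b C) (\<pi> - {C})"
        and j = "\<lambda>\<sigma>. (insert (blk \<sigma> - {b}) (\<sigma> - {blk \<sigma>}), blk \<sigma> - {b})"])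
    fix \<sigma> assume "\<sigma> \<in> {\<sigma>. partition_on (insert b A) \<sigma> \<and> {b} \<notin> \<sigma>}"
    then have s: "partition_on (insert b A) \<sigma>" "{b} \<notin> \<sigma>" by auto
    obtain D where D: "D \<in> \<sigma>" "b \<in> D" using ex[OF s(1)] by auto
    have bD: "blk \<sigma> = D" using blk[OF s(1) D] .
    have dis: "disjoint \<sigma>" "{} \<notin> \<sigma>" "\<Union>\<sigma> = insert b A" using s unfolding partition_on_def by auto
    have ne: "D - {b} \<noteq> {}" using D s(2) by (metis Diff_eq_empty_iff subset_singletonD empty_iff)
    have other: "D' \<inter> D = {}" if "D' \<in> \<sigma>" "D' \<noteq> D" for D'
      using disjointD[OF dis(1)] that D by blast
    have nin: "D - {b} \<notin> \<sigma> - {D}"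
      using other[of "D - {b}"] ne by blast
    then have "insert (D - {b}) (\<sigma> - {D}) - {D - {b}} = \<sigma> - {D}"
      by simp
    then have i: "insert (insert b (D - {b})) (insert (D - {b}) (\<sigma> - {D}) - {D - {b}}) = \<sigma>"
      using D by (simp add: insert_absorb)
    show "(case (insert (blk \<sigma> - {b}) (\<sigma> - {blk \<sigma>}), blk \<sigma> - {b}) of
      (\<pi>, C) \<Rightarrow> insert (insert b C) (\<pi> - {C})) = \<sigma>"
      "(case (insert (blk \<sigma> - {b}) (\<sigma> - {blk \<sigma>}), blk \<sigma> - {b}) of
      (\<pi>, C) \<Rightarrow> G (insert (insert b C) (\<pi> - {C}))) = G \<sigma>"
      by (simp_all only: bD i prod.case)
    have "partition_on A (insert (D - {b}) (\<sigma> - {D}))"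
    proof (rule partition_onI)
      have "b \<notin> \<Union>(\<sigma> - {D})" using other D by blast
      moreover have "\<Union>\<sigma> = D \<union> \<Union>(\<sigma> - {D})" using D by blast
      ultimately have "\<Union>(insert (D - {b}) (\<sigma> - {D})) = \<Union>\<sigma> - {b}" by auto
      then show "\<Union>(insert (D - {b}) (\<sigma> - {D})) = A" using dis(3) b by simp
      show "{} \<notin> insert (D - {b}) (\<sigma> - {D})" using ne dis(2) by auto
      show "disjnt p q" if "p \<in> insert (D - {b}) (\<sigma> - {D})"
        "q \<in> insert (D - {b}) (\<sigma> - {D})" "p \<noteq> q" for p q
        using that other disjointD[OF dis(1), of p q] unfolding disjnt_def by blast
    qed
    then show "(insert (blk \<sigma> - {b}) (\<sigma> - {blk \<sigma>}), blk \<sigma> - {b}) \<in> (SIGMA \<pi>:{\<pi>. partition_on A \<pi>}. \<pi>)"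
      by (simp add: bD)
  next
    fix x assume "x \<in> (SIGMA \<pi>:{\<pi>. partition_on A \<pi>}. \<pi>)"
    then obtain \<pi> C where x: "x = (\<pi>, C)" "partition_on A \<pi>" "C \<in> \<pi>" by auto
    have part: "partition_on (insert b A) (insert (insert b C) (\<pi> - {C}))"
      using partition_on_insert_into_block[OF x(2,3) b] .
    have bl: "blk (insert (insert b C) (\<pi> - {C})) = insert b C"
      by (rule blk[OF part]) auto
    have nC: "b \<notin> C" "insert b C \<notin> \<pi>" "C \<noteq> {}" "{b} \<notin> \<pi>"
      using notb[OF x(2)] x(3) partition_onD3[OF x(2)] by auto
    have "insert b C - {b} = C" "insert (insert b C) (\<pi> - {C}) - {insert b C} = \<pi> - {C}"
      "insert C (\<pi> - {C}) = \<pi>"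
      using nC x(3) by auto
    then show "(insert (blk (case x of (\<pi>, C) \<Rightarrow> insert (insert b C) (\<pi> - {C})) - {b})
        ((case x of (\<pi>, C) \<Rightarrow> insert (insert b C) (\<pi> - {C})) - {blk (case x of (\<pi>, C) \<Rightarrow> insert (insert b C) (\<pi> - {C}))}),
       blk (case x of (\<pi>, C) \<Rightarrow> insert (insert b C) (\<pi> - {C})) - {b}) = x"
      by (simp only: x(1) bl prod.case)
    show "(case x of (\<pi>, C) \<Rightarrow> insert (insert b C) (\<pi> - {C})) \<in> {\<sigma>. partition_on (insert b A) \<sigma> \<and> {b} \<notin> \<sigma>}"
      using part nC by (auto simp: x(1))
  qed
  have "(\<Sum>\<sigma> | partition_on (insert b A) \<sigma>. G \<sigma>) =
      (\<Sum>\<sigma> | partition_on (insert b A) \<sigma> \<and> {b} \<in> \<sigma>. G \<sigma>) +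
      (\<Sum>\<sigma> | partition_on (insert b A) \<sigma> \<and> {b} \<notin> \<sigma>. G \<sigma>)"
    using finp[of "insert b A"] fin
    by (subst sum.union_disjoint[symmetric]) (auto intro!: sum.cong)
  also have "\<dots> = (\<Sum>\<pi> | partition_on A \<pi>. G (insert {b} \<pi>)) +
      (\<Sum>\<pi> | partition_on A \<pi>. \<Sum>C\<in>\<pi>. G (insert (insert b C) (\<pi> - {C})))"
    unfolding single into
    by (subst sum.Sigma[symmetric]) (use finp[OF fin] finite_elements[OF fin] in auto)
  finally show ?thesis by (simp add: sum.distrib)
qed

section \<open>Sums over injections and power sums\<close>

definition injective_sum :: "'j set \<Rightarrow> 'b set \<Rightarrow> ('b \<Rightarrow> 'j \<Rightarrow> 'r::comm_ring_1) \<Rightarrow> 'r" where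
  "injective_sum J P X = (\<Sum>f | f \<in> P \<rightarrow>\<^sub>E J \<and> inj_on f P. \<Prod>b\<in>P. X b (f b))"

lemma finite_injections: "finite J \<Longrightarrow> finite P \<Longrightarrow> finite {f. f \<in> P \<rightarrow>\<^sub>E J \<and> inj_on f P}"
  by (rule finite_subset[of _ "P \<rightarrow>\<^sub>E J"]) (auto intro: finite_PiE)

lemma injective_sum_empty [simp]: "injective_sum J {} X = 1"
proof -
  have "{f. f \<in> {} \<rightarrow>\<^sub>E J \<and> inj_on f {}} = {\<lambda>_. undefined}" by auto
  then show ?thesis by (simp add: injective_sum_def)
qed

text \<open>
  An injection on \<open>insert b P\<close> is an injection \<open>f\<close> on \<open>P\<close> together with a value at \<open>b\<close> outside the
  image of \<open>f\<close>.
\<close>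

lemma injective_sum_insert:
  assumes "finite J" "finite P" "b \<notin> P"
  shows "injective_sum J (insert b P) X =
    (\<Sum>f | f \<in> P \<rightarrow>\<^sub>E J \<and> inj_on f P. (\<Sum>j\<in>J - f ` P. X b j) * (\<Prod>a\<in>P. X a (f a)))"
proof -
  have "injective_sum J (insert b P) X =
    (\<Sum>(f, j)\<in>(SIGMA f:{f. f \<in> P \<rightarrow>\<^sub>E J \<and> inj_on f P}. J - f ` P). X b j * (\<Prod>a\<in>P. X a (f a)))"
    unfolding injective_sum_def
  proof (rule sum.reindex_bij_witness[where i = "\<lambda>(f, j). f(b := j)"
        and j = "\<lambda>g. (g(b := undefined), g b)"])
    fix g assume "g \<in> {f. f \<in> insert b P \<rightarrow>\<^sub>E J \<and> inj_on f (insert b P)}"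
    then have g: "g \<in> insert b P \<rightarrow>\<^sub>E J" "inj_on g (insert b P)" by auto
    show "(case (g(b := undefined), g b) of (f, j) \<Rightarrow> f(b := j)) = g" by simp
    have im: "g(b := undefined) ` P = g ` P" using assms(3) by auto
    have "inj_on (g(b := undefined)) P"
      using g(2) assms(3) by (auto simp: inj_on_def)
    moreover have "g(b := undefined) \<in> P \<rightarrow>\<^sub>E J"
      using g(1) assms(3) by (auto simp: PiE_def extensional_def)
    moreover have "g b \<in> J - g ` P" using g assms(3) by (auto simp: inj_on_def)
    ultimately show "(g(b := undefined), g b) \<in> (SIGMA f:{f. f \<in> P \<rightarrow>\<^sub>E J \<and> inj_on f P}. J - f ` P)"
      using im by auto
    have "(\<Prod>a\<in>P. X a ((g(b := undefined)) a)) = (\<Prod>a\<in>P. X a (g a))"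
      by (rule prod.cong) (use assms(3) in auto)
    then show "(case (g(b := undefined), g b) of (f, j) \<Rightarrow> X b j * (\<Prod>a\<in>P. X a (f a)))
       = (\<Prod>b\<in>insert b P. X b (g b))"
      using assms by simp
  next
    fix x assume "x \<in> (SIGMA f:{f. f \<in> P \<rightarrow>\<^sub>E J \<and> inj_on f P}. J - f ` P)"
    then obtain f j where x: "x = (f, j)" "f \<in> P \<rightarrow>\<^sub>E J" "inj_on f P" "j \<in> J" "j \<notin> f ` P" by auto
    have fb: "f b = undefined" using x(2) assms(3) by (auto simp: PiE_def extensional_def)
    then show "((case x of (f, j) \<Rightarrow> f(b := j))(b := undefined), (case x of (f, j) \<Rightarrow> f(b := j)) b) = x"
      by (auto simp: x(1))
    have "inj_on (f(b := j)) (insert b P)"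
      using x(3,5) assms(3) by (auto simp: inj_on_def)
    moreover have "f(b := j) \<in> insert b P \<rightarrow>\<^sub>E J"
      using x(2,4) by (auto simp: PiE_def extensional_def)
    ultimately show "(case x of (f, j) \<Rightarrow> f(b := j)) \<in> {f. f \<in> insert b P \<rightarrow>\<^sub>E J \<and> inj_on f (insert b P)}"
      by (simp add: x(1))
  qed
  also have "\<dots> = (\<Sum>f | f \<in> P \<rightarrow>\<^sub>E J \<and> inj_on f P. \<Sum>j\<in>J - f ` P. X b j * (\<Prod>a\<in>P. X a (f a)))"
    by (subst sum.Sigma[symmetric]) (use assms finite_injections[of J P] in auto)
  finally show ?thesis by (simp add: sum_distrib_right)
qed

text \<open>
  Only the weights matter, not the names of the indices. This identifies the sum over a partition in
  which the block \<open>C\<close> has been enlarged to \<open>insert b C\<close> with a sum over the old partition in which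
  the weight of \<open>C\<close> has been modified.
\<close>

lemma injective_sum_cong_insert:
  assumes "finite J" "finite P" "b \<notin> P" "c \<notin> P"
    and "X b = Y c" "\<And>a. a \<in> P \<Longrightarrow> X a = Y a"
  shows "injective_sum J (insert b P) X = injective_sum J (insert c P) Y"
  using assms by (simp add: injective_sum_insert cong: prod.cong)

text \<open>
  The value \<open>j\<close> at the new index \<open>b\<close> either avoids the image of the injection \<open>f\<close>, or equals
  \<open>f a\<close> for exactly one \<open>a\<close>; in the second case the weight at \<open>b\<close> is absorbed into the weight at
  \<open>a\<close>. Read from left to right, the identity expands ordinary products; solved for the first summand
  on the right, it reduces an injective sum to smaller ones.
\<close>

lemma sum_times_injective_sum:
  assumes "finite J" "finite P" "b \<notin> P"
  shows "(\<Sum>j\<in>J. X b j) * injective_sum J P X =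
    injective_sum J (insert b P) X + (\<Sum>a\<in>P. injective_sum J P (X(a := \<lambda>j. X a j * X b j)))"
proof -
  let ?I = "{f. f \<in> P \<rightarrow>\<^sub>E J \<and> inj_on f P}"
  have split: "(\<Sum>j\<in>J. X b j) * (\<Prod>a\<in>P. X a (f a)) =
      (\<Sum>j\<in>J - f ` P. X b j) * (\<Prod>a\<in>P. X a (f a)) +
      (\<Sum>a\<in>P. \<Prod>c\<in>P. (X(a := \<lambda>j. X a j * X b j)) c (f c))" if "f \<in> ?I" for f
  proof -
    have f: "f ` P \<subseteq> J" "inj_on f P" using that by auto
    have "(\<Sum>j\<in>J. X b j) = (\<Sum>j\<in>J - f ` P. X b j) + (\<Sum>a\<in>P. X b (f a))"
      using sum.subset_diff[OF f(1) assms(1), of "X b"] sum.reindex[OF f(2), of "X b"] by simp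
    moreover have "(\<Prod>c\<in>P. (X(a := \<lambda>j. X a j * X b j)) c (f c)) = X b (f a) * (\<Prod>c\<in>P. X c (f c))"
      if "a \<in> P" for a
    proof -
      have "(\<Prod>c\<in>P. (X(a := \<lambda>j. X a j * X b j)) c (f c)) =
          (X a (f a) * X b (f a)) * (\<Prod>c\<in>P - {a}. X c (f c))"
        using assms(2) that by (subst prod.remove[of P a]) (auto intro!: prod.cong)
      also have "\<dots> = X b (f a) * (\<Prod>c\<in>P. X c (f c))"
        using assms(2) that prod.remove[of P a "\<lambda>c. X c (f c)"] by (simp add: mult_ac)
      finally show ?thesis .
    qed
    ultimately show ?thesis by (simp add: distrib_right sum_distrib_right)
  qed
  show ?thesis
    unfolding injective_sum_insert[OF assms] unfolding injective_sum_def sum_distrib_left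
    by (subst sum.swap, subst sum.distrib[symmetric]) (rule sum.cong[OF refl split])
qed

text \<open>
  Expanding the product gives a sum over all functions \<open>I \<rightarrow> J\<close>; the part that belongs to \<open>\<pi>\<close>
  collects the functions whose nonempty fibres are the blocks of \<open>\<pi>\<close>.
\<close>

lemma prod_sum_eq_partition_injective_sums:
  fixes x :: "'i \<Rightarrow> 'j \<Rightarrow> 'r::comm_ring_1"
  assumes J: "finite J" and I: "finite I"
  shows "(\<Prod>i\<in>I. \<Sum>j\<in>J. x i j) =
    (\<Sum>\<pi> | partition_on I \<pi>. injective_sum J \<pi> (\<lambda>B j. \<Prod>i\<in>B. x i j))"
  using I
proof (induction I)
  case empty
  then show ?case by (simp add: partition_on_empty)
next
  case (insert b I)
  define Y where "Y = (\<lambda>B j. \<Prod>i\<in>B. x i j)"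
  have step: "(\<Sum>j\<in>J. x b j) * injective_sum J \<pi> Y = injective_sum J (insert {b} \<pi>) Y +
      (\<Sum>C\<in>\<pi>. injective_sum J (insert (insert b C) (\<pi> - {C})) Y)" if "partition_on I \<pi>" for \<pi>
  proof -
    have fin: "finite \<pi>" using finite_elements[OF insert.hyps(1) that] .
    have nb: "b \<notin> C" and finC: "finite C" if "C \<in> \<pi>" for C
      using that insert.hyps \<open>partition_on I \<pi>\<close> finite_subset[of C I]
      unfolding partition_on_def by auto
    have "{b} \<notin> \<pi>" using nb by auto
    have "injective_sum J \<pi> (Y(C := \<lambda>j. Y C j * Y {b} j)) =
        injective_sum J (insert (insert b C) (\<pi> - {C})) Y" if C: "C \<in> \<pi>" for C
    proof -
      have "insert b C \<notin> \<pi>" using nb by auto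
      then have "injective_sum J (insert C (\<pi> - {C})) (Y(C := \<lambda>j. Y C j * Y {b} j)) =
        injective_sum J (insert (insert b C) (\<pi> - {C})) Y"
        using J fin nb[OF C] finC[OF C]
        by (intro injective_sum_cong_insert) (auto simp: Y_def mult.commute)
      then show ?thesis using C by (simp add: insert_absorb)
    qed
    then show ?thesis
      using sum_times_injective_sum[OF J fin \<open>{b} \<notin> \<pi>\<close>, of Y] by (simp add: Y_def)
  qed
  have "(\<Prod>i\<in>insert b I. \<Sum>j\<in>J. x i j) =
      (\<Sum>\<pi> | partition_on I \<pi>. (\<Sum>j\<in>J. x b j) * injective_sum J \<pi> Y)"
    using insert by (simp add: Y_def sum_distrib_left)
  also have "\<dots> = (\<Sum>\<sigma> | partition_on (insert b I) \<sigma>. injective_sum J \<sigma> Y)"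
    using sum_partitions_insert[OF insert.hyps, of "\<lambda>\<sigma>. injective_sum J \<sigma> Y"] step by simp
  finally show ?case by (simp add: Y_def)
qed

text \<open>
  The number of cyclic permutations of \<open>m\<close> points, counted with sign. Truncated subtraction gives
  the value 1 at \<open>m = 0\<close>, which agrees with $E[(\chi)_0] = 1$.
\<close>

definition signed_cycle_count :: "nat \<Rightarrow> 'r::comm_ring_1" where
  "signed_cycle_count m = (-1) ^ (m - 1) * of_nat (fact (m - 1))"

lemma signed_cycle_count_Suc: "m > 0 \<Longrightarrow> signed_cycle_count (Suc m) = - of_nat m * signed_cycle_count m"
  by (cases m) (simp_all add: signed_cycle_count_def algebra_simps)

lemma signed_cycle_count_1 [simp]: "signed_cycle_count (Suc 0) = 1"
  by (simp add: signed_cycle_count_def)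

text \<open>
  This is the inversion of the preceding expansion: the coefficients are the Moebius function of the
  partition lattice. In the induction step the new index \<open>b\<close> is either a block of its own or is
  absorbed, with a minus sign, by one of the \<open>card C\<close> elements of a block \<open>C\<close>; the factor
  \<open>- card C\<close> is the ratio of consecutive signed cycle counts.
\<close>

lemma injective_sum_eq_power_sums:
  fixes X :: "'b \<Rightarrow> 'j \<Rightarrow> 'r::comm_ring_1"
  assumes J: "finite J" and P: "finite P"
  shows "injective_sum J P X =
    (\<Sum>\<tau> | partition_on P \<tau>. \<Prod>C\<in>\<tau>. signed_cycle_count (card C) * (\<Sum>j\<in>J. \<Prod>b\<in>C. X b j))"
  using P
proof (induction P arbitrary: X)
  case empty
  then show ?case by (simp add: partition_on_empty)
next
  case (insert b P)
  define p where "p X C = (\<Sum>j\<in>J. \<Prod>b\<in>C. X b j)" for X :: "'b \<Rightarrow> 'j \<Rightarrow> 'r" and C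
  define T where "T X \<tau> = (\<Prod>C\<in>\<tau>. signed_cycle_count (card C) * p X C)" for X and \<tau>
  \<comment> \<open>The weights after \<open>b\<close> has been absorbed by \<open>a\<close>.\<close>
  define X' where "X' a = X(a := \<lambda>j. X a j * X b j)" for a
  have step: "(\<Sum>j\<in>J. X b j) * T X \<tau> - (\<Sum>a\<in>P. T (X' a) \<tau>) =
      T X (insert {b} \<tau>) + (\<Sum>C\<in>\<tau>. T X (insert (insert b C) (\<tau> - {C})))"
    if part: "partition_on P \<tau>" for \<tau>
  proof -
    have fin: "finite \<tau>" using finite_elements[OF insert.hyps(1) part] .
    have un: "P = \<Union>\<tau>" using partition_onD1[OF part] .
    have nb: "b \<notin> C" and finC: "finite C" and ne: "C \<noteq> {}" if "C \<in> \<tau>" for C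
      using that insert.hyps part finite_subset[of C P]
      unfolding partition_on_def by auto
    have dis: "a \<notin> D" if "C \<in> \<tau>" "D \<in> \<tau>" "a \<in> C" "D \<noteq> C" for a C D
      using that partition_onD2[OF part] unfolding pairwise_def disjnt_def by auto
    have "{b} \<notin> \<tau>" using nb by auto
    then have new: "T X (insert {b} \<tau>) = (\<Sum>j\<in>J. X b j) * T X \<tau>"
      using fin by (simp add: T_def p_def)
    have "(\<Sum>a\<in>P. T (X' a) \<tau>) = (\<Sum>C\<in>\<tau>. \<Sum>a\<in>C. T (X' a) \<tau>)"
      unfolding un using partition_onD2[OF part] finC
      by (subst sum.Union_disjoint) (auto simp: pairwise_def disjnt_def)
    also have "\<dots> = (\<Sum>C\<in>\<tau>. - T X (insert (insert b C) (\<tau> - {C})))"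
    proof (rule sum.cong[OF refl])
      fix C assume C: "C \<in> \<tau>"
      let ?R = "\<Prod>D\<in>\<tau> - {C}. signed_cycle_count (card D) * p X D"
      have "T (X' a) \<tau> = signed_cycle_count (card C) * p X (insert b C) * ?R" if a: "a \<in> C" for a
      proof -
        have "(\<Prod>c\<in>C. X' a c j) = (\<Prod>c\<in>insert b C. X c j)" for j
        proof -
          have "(\<Prod>c\<in>C. X' a c j) = (X a j * X b j) * (\<Prod>c\<in>C - {a}. X c j)"
            using finC[OF C] a by (subst prod.remove[of C a]) (auto simp: X'_def intro!: prod.cong)
          also have "\<dots> = X b j * (\<Prod>c\<in>C. X c j)"
            using finC[OF C] a prod.remove[of C a "\<lambda>c. X c j"] by (simp add: mult_ac)
          finally show ?thesis using finC[OF C] nb[OF C] by simp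
        qed
        moreover have "(\<Prod>c\<in>D. X' a c j) = (\<Prod>c\<in>D. X c j)" if "D \<in> \<tau> - {C}" for D j
          by (rule prod.cong) (use that dis[OF C _ a, of D] in \<open>auto simp: X'_def\<close>)
        ultimately show ?thesis
          using fin C unfolding T_def p_def by (subst prod.remove[of \<tau> C]) simp_all
      qed
      then have "(\<Sum>a\<in>C. T (X' a) \<tau>) = of_nat (card C) * (signed_cycle_count (card C) * p X (insert b C) * ?R)"
        by simp
      also have "\<dots> = - (signed_cycle_count (Suc (card C)) * p X (insert b C) * ?R)"
        using finC[OF C] ne[OF C] by (subst signed_cycle_count_Suc) (auto simp: card_gt_0_iff mult_ac)
      also have "\<dots> = - T X (insert (insert b C) (\<tau> - {C}))"
      proof -
        have "insert b C \<notin> \<tau> - {C}" using nb by auto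
        then show ?thesis using fin finC[OF C] nb[OF C] by (simp add: T_def)
      qed
      finally show "(\<Sum>a\<in>C. T (X' a) \<tau>) = - T X (insert (insert b C) (\<tau> - {C}))" .
    qed
    finally show ?thesis using new by (simp add: sum_negf)
  qed
  have IH: "injective_sum J P Z = (\<Sum>\<tau> | partition_on P \<tau>. T Z \<tau>)" for Z
    using insert.IH[of Z] by (simp add: T_def p_def)
  have "injective_sum J (insert b P) X =
      (\<Sum>j\<in>J. X b j) * injective_sum J P X - (\<Sum>a\<in>P. injective_sum J P (X' a))"
    using sum_times_injective_sum[OF J insert.hyps, of X] by (simp add: X'_def)
  also have "\<dots> = (\<Sum>\<tau> | partition_on P \<tau>. (\<Sum>j\<in>J. X b j) * T X \<tau> - (\<Sum>a\<in>P. T (X' a) \<tau>))"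
    unfolding IH by (subst sum.swap) (simp add: sum_distrib_left sum_subtractf)
  also have "\<dots> = (\<Sum>\<sigma> | partition_on (insert b P) \<sigma>. T X \<sigma>)"
    using sum_partitions_insert[OF insert.hyps, of "T X"] step by simp
  finally show ?case by (simp add: T_def p_def)
qed

section \<open>Falling factorials\<close>

text \<open>
  If \<open>P\<close> is larger than \<open>J\<close> there is no injection, and the falling factorial has a zero factor.
\<close>

lemma card_injections:
  assumes "finite J" "finite P"
  shows "of_nat (card {f. f \<in> P \<rightarrow>\<^sub>E J \<and> inj_on f P}) = (falling (of_nat (card J)) (card P) :: 'r::comm_ring_1)"
proof -
  let ?n = "card J"
  have c: "card {f. f \<in> P \<rightarrow>\<^sub>E J \<and> inj_on f P} = (\<Prod>i<card P. ?n - i)"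
    using card_inj_on_subset_funcset[OF assms(2,1) subset_refl] by (simp add: atLeast0LessThan)
  show ?thesis
  proof (cases "card P \<le> ?n")
    case True
    then show ?thesis by (simp add: c falling_def of_nat_diff)
  next
    case False
    then have "\<exists>i\<in>{..<card P}. ?n - i = 0"
      and "\<exists>i\<in>{..<card P}. of_nat ?n - of_nat i = (0 :: 'r)"
      by (auto intro!: bexI[of _ ?n])
    then have "(\<Prod>i<card P. ?n - i) = 0" "(falling (of_nat ?n) (card P) :: 'r) = 0"
      unfolding falling_def by (auto intro!: prod_zero)
    then show ?thesis by (simp only: c of_nat_0)
  qed
qed

lemma falling_Suc: "falling x (Suc m) = falling x m * (x - of_nat m)"
  by (simp add: falling_def)

lemma falling_0 [simp]: "falling x 0 = 1"
  by (simp add: falling_def)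

lemma poly_falling: "poly (falling [:0, 1:] m) x = falling x m"
  by (induction m) (simp_all add: falling_Suc)

lemma falling_of_nat_nonzero:
  assumes "m \<le> n"
  shows "falling (of_nat n) m \<noteq> (0 :: 'k::field_char_0)"
  using assms by (auto simp: falling_def)

lemma falling_X_Suc:
  "(falling [:0, 1:] (Suc m) :: 'r::comm_ring_1 poly) =
    pCons 0 (falling [:0, 1:] m) - smult (of_nat m) (falling [:0, 1:] m)"
proof -
  have "(falling [:0, 1:] (Suc m) :: 'r poly) = ([:0, 1:] - [:of_nat m:]) * falling [:0, 1:] m"
    unfolding falling_Suc of_nat_poly by (rule mult.commute)
  then show ?thesis by (simp add: left_diff_distrib)
qed

lemma coeff_0_falling: "m > 0 \<Longrightarrow> coeff (falling [:0, 1:] m :: 'r::comm_ring_1 poly) 0 = 0"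
proof (induction m)
  case (Suc m)
  then show ?case by (cases "m = 0") (simp_all add: falling_X_Suc)
qed simp

text \<open>
  The left-hand side is $E[(\chi)_m]$, because the singleton umbra retains only the coefficients of
  degree 0 and 1.
\<close>

lemma low_coeffs_falling:
  "coeff (falling [:0, 1:] m :: 'r::comm_ring_1 poly) 0 + coeff (falling [:0, 1:] m) 1 = signed_cycle_count m"
proof (induction m)
  case 0
  then show ?case by (simp add: signed_cycle_count_def)
next
  case (Suc m)
  show ?case
  proof (cases "m = 0")
    case True
    then show ?thesis by (simp add: falling_X_Suc)
  next
    case False
    then have "coeff (falling [:0, 1:] m :: 'r poly) 0 = 0" by (simp add: coeff_0_falling)
    then show ?thesis
      using False Suc by (simp add: falling_X_Suc signed_cycle_count_Suc)
  qed
qed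

lemma poly_eqI_of_nat:
  fixes p q :: "'k::field_char_0 poly"
  assumes "\<And>n. poly p (of_nat n) = poly q (of_nat n)"
  shows "p = q"
proof (rule ccontr)
  assume "p \<noteq> q"
  then have "p - q \<noteq> 0" by simp
  then have "finite {x. poly (p - q) x = 0}" by (rule poly_roots_finite)
  moreover have "range (of_nat :: nat \<Rightarrow> 'k) \<subseteq> {x. poly (p - q) x = 0}"
    using assms by auto
  ultimately have "finite (range (of_nat :: nat \<Rightarrow> 'k))" by (rule rev_finite_subset)
  moreover have "inj (of_nat :: nat \<Rightarrow> 'k)" by (rule inj_of_nat)
  ultimately have "finite (UNIV :: nat set)" by (rule finite_imageD)
  then show False by simp
qed

section \<open>Power products and occurring umbrae\<close>

lemma poly_mapping_eq_sum_single:
  assumes "finite F" "Poly_Mapping.keys p \<subseteq> F"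
  shows "p = (\<Sum>t\<in>F. Poly_Mapping.single t (Poly_Mapping.lookup p t))"
proof (rule poly_mapping_eqI)
  fix x
  have "(\<Sum>t\<in>F. Poly_Mapping.lookup (Poly_Mapping.single t (Poly_Mapping.lookup p t)) x) =
      (\<Sum>t\<in>F. if t = x then Poly_Mapping.lookup p t else 0)"
    by (rule sum.cong) (auto simp: lookup_single when_def)
  also have "\<dots> = Poly_Mapping.lookup p x"
    using assms by (auto simp: in_keys_iff)
  finally show "Poly_Mapping.lookup p x =
      Poly_Mapping.lookup (\<Sum>t\<in>F. Poly_Mapping.single t (Poly_Mapping.lookup p t)) x"
    by (simp add: lookup_sum)
qed

lemma sum_single_keys:
  "(\<Sum>t\<in>Poly_Mapping.keys p. Poly_Mapping.single t (Poly_Mapping.lookup p t)) = p"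
  using poly_mapping_eq_sum_single[of "Poly_Mapping.keys p" p] by simp

lemma scal_0 [simp]: "scal 0 = 0"
  by (simp add: scal_def)

lemma scal_1 [simp]: "scal 1 = 1"
  by (simp add: scal_def)

lemma scal_mult: "scal (c * d) = scal c * scal d"
  by (simp add: scal_def mult_single)

lemma scal_add: "scal (c + d) = scal c + scal d"
  by (simp add: scal_def single_add)

lemma scal_prod: "scal (\<Prod>x\<in>F. c x) = (\<Prod>x\<in>F. scal (c x))"
  by (induction F rule: infinite_finite_induct) (simp_all add: scal_mult)

lemma scal_of_nat: "scal (of_nat m) = of_nat m"
  by (induction m) (simp_all add: scal_add)

lemma scal_power: "scal (c ^ m) = scal c ^ m"
  by (induction m) (simp_all add: scal_mult)

lemma scal_signed_cycle_count:
  "scal (signed_cycle_count m :: 'k) = (signed_cycle_count m :: ('a, 'k::comm_ring_1) umbral_poly)"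
proof -
  have "scal (- 1 :: 'k) = (- 1 :: ('a, 'k) umbral_poly)"
    by (simp add: scal_def single_uminus)
  then show ?thesis
    unfolding signed_cycle_count_def scal_mult scal_of_nat scal_power by simp
qed

lemma single_eq_scal_mult: "Poly_Mapping.single t c = scal c * Poly_Mapping.single t 1"
  by (simp add: scal_def mult_single)

lemma umb_power: "umb \<alpha> ^ m = Poly_Mapping.single (Poly_Mapping.single \<alpha> m) 1"
  by (induction m) (simp_all add: umb_def mult_single single_add[symmetric])

lemma single_eq_prod_umb:
  assumes "finite F" "Poly_Mapping.keys t \<subseteq> F"
  shows "Poly_Mapping.single t 1 = (\<Prod>\<alpha>\<in>F. umb \<alpha> ^ Poly_Mapping.lookup t \<alpha>)"
proof -
  have "(\<Prod>\<alpha>\<in>F. Poly_Mapping.single (g \<alpha>) 1) = Poly_Mapping.single (\<Sum>\<alpha>\<in>F. g \<alpha>) 1" for g :: "_ \<Rightarrow> _ \<Rightarrow>\<^sub>0 nat"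
    using assms(1) by (induction F) (simp_all add: mult_single)
  then have "(\<Prod>\<alpha>\<in>F. umb \<alpha> ^ Poly_Mapping.lookup t \<alpha>) =
      Poly_Mapping.single (\<Sum>\<alpha>\<in>F. Poly_Mapping.single \<alpha> (Poly_Mapping.lookup t \<alpha>)) 1"
    by (simp add: umb_power)
  then show ?thesis
    using poly_mapping_eq_sum_single[OF assms] by metis
qed

lemma prod_power_lookup:
  fixes g :: "'a \<Rightarrow> 'r::comm_monoid_mult"
  assumes "finite F" "Poly_Mapping.keys t \<subseteq> F"
  shows "(\<Prod>\<alpha>\<in>Poly_Mapping.keys t. g \<alpha> ^ Poly_Mapping.lookup t \<alpha>) =
    (\<Prod>\<alpha>\<in>F. g \<alpha> ^ Poly_Mapping.lookup t \<alpha>)"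
  using assms by (intro prod.mono_neutral_left) (auto simp: in_keys_iff)

lemma prod_power_lookup_add:
  fixes g :: "'a \<Rightarrow> 'r::comm_monoid_mult"
  shows "(\<Prod>\<alpha>\<in>Poly_Mapping.keys (t + u). g \<alpha> ^ Poly_Mapping.lookup (t + u) \<alpha>) =
    (\<Prod>\<alpha>\<in>Poly_Mapping.keys t. g \<alpha> ^ Poly_Mapping.lookup t \<alpha>) *
    (\<Prod>\<alpha>\<in>Poly_Mapping.keys u. g \<alpha> ^ Poly_Mapping.lookup u \<alpha>)"
proof -
  let ?F = "Poly_Mapping.keys t \<union> Poly_Mapping.keys u"
  have eq: "(\<Prod>\<alpha>\<in>Poly_Mapping.keys v. g \<alpha> ^ Poly_Mapping.lookup v \<alpha>) =
      (\<Prod>\<alpha>\<in>?F. g \<alpha> ^ Poly_Mapping.lookup v \<alpha>)" if "v \<in> {t, u, t + u}" for v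
    using that keys_add[of t u] by (intro prod_power_lookup) auto
  show ?thesis
    using eq[of t] eq[of u] eq[of "t + u"] by (simp add: lookup_add power_add prod.distrib)
qed

lemma umbrae_single: "umbrae (Poly_Mapping.single t c) \<subseteq> Poly_Mapping.keys t"
  by (auto simp: umbrae_def split: if_splits)

lemma umbrae_1 [simp]: "umbrae 1 = {}"
  unfolding umbrae_def by simp

lemma umbrae_mult: "umbrae (p * q) \<subseteq> umbrae p \<union> umbrae q"
proof
  fix \<alpha> assume "\<alpha> \<in> umbrae (p * q)"
  then obtain t where t: "t \<in> Poly_Mapping.keys (p * q)" "\<alpha> \<in> Poly_Mapping.keys t"
    by (auto simp: umbrae_def)
  then obtain u v where "u \<in> Poly_Mapping.keys p" "v \<in> Poly_Mapping.keys q" "t = u + v"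
    using keys_mult[of p q] by auto
  then show "\<alpha> \<in> umbrae p \<union> umbrae q"
    using t(2) keys_add[of u v] by (auto simp: umbrae_def)
qed

lemma umbrae_prod: "umbrae (\<Prod>x\<in>F. p x) \<subseteq> (\<Union>x\<in>F. umbrae (p x))"
proof (induction F rule: infinite_finite_induct)
  case (insert x F)
  then show ?case using umbrae_mult[of "p x" "\<Prod>x\<in>F. p x"] by auto
qed simp_all

lemma umbrae_sum: "umbrae (\<Sum>x\<in>F. p x) \<subseteq> (\<Union>x\<in>F. umbrae (p x))"
  unfolding umbrae_def using keys_sum[of p F] by blast

lemma umbrae_umb_power: "umbrae (umb \<alpha> ^ m) \<subseteq> {\<alpha>}"
  using umbrae_single[of "Poly_Mapping.single \<alpha> m" 1] by (auto simp: umb_power split: if_splits)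

section \<open>Substitution of umbrae is a ring homomorphism\<close>

lemma replace_umbrae_eq_sum:
  assumes "finite F" "Poly_Mapping.keys p \<subseteq> F"
  shows "replace_umbrae h p =
    (\<Sum>t\<in>F. scal (Poly_Mapping.lookup p t) *
      (\<Prod>\<alpha>\<in>Poly_Mapping.keys t. umb (h \<alpha>) ^ Poly_Mapping.lookup t \<alpha>))"
  using assms unfolding replace_umbrae_def
  by (intro sum.mono_neutral_left) (auto simp: in_keys_iff)

lemma replace_umbrae_add: "replace_umbrae h (p + q) = replace_umbrae h p + replace_umbrae h q"
  using keys_add[of p q]
  by (simp add: replace_umbrae_eq_sum[where F = "Poly_Mapping.keys p \<union> Poly_Mapping.keys q"]
      lookup_add scal_add distrib_right sum.distrib)

lemma replace_umbrae_0 [simp]: "replace_umbrae h 0 = 0"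
  by (simp add: replace_umbrae_def)

lemma replace_umbrae_sum: "replace_umbrae h (\<Sum>x\<in>F. p x) = (\<Sum>x\<in>F. replace_umbrae h (p x))"
  by (induction F rule: infinite_finite_induct) (simp_all add: replace_umbrae_add)

lemma replace_umbrae_single:
  "replace_umbrae h (Poly_Mapping.single t c) =
    scal c * (\<Prod>\<alpha>\<in>Poly_Mapping.keys t. umb (h \<alpha>) ^ Poly_Mapping.lookup t \<alpha>)"
  by (cases "c = 0") (simp_all add: replace_umbrae_def)

lemma replace_umbrae_single_mult:
  "replace_umbrae h (Poly_Mapping.single (t + u) (c * d)) =
   replace_umbrae h (Poly_Mapping.single t c) * replace_umbrae h (Poly_Mapping.single u d)"
  unfolding replace_umbrae_single prod_power_lookup_add scal_mult by (simp only: mult_ac)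

lemma replace_umbrae_mult: "replace_umbrae h (p * q) = replace_umbrae h p * replace_umbrae h q"
proof -
  let ?s = "\<lambda>p t. Poly_Mapping.single t (Poly_Mapping.lookup p t)"
  let ?P = "\<Sum>t\<in>Poly_Mapping.keys p. ?s p t" and ?Q = "\<Sum>u\<in>Poly_Mapping.keys q. ?s q u"
  have "replace_umbrae h (?P * ?Q) = replace_umbrae h ?P * replace_umbrae h ?Q"
    unfolding sum_product replace_umbrae_sum mult_single replace_umbrae_single_mult ..
  then show ?thesis unfolding sum_single_keys .
qed

lemma replace_umbrae_1 [simp]: "replace_umbrae h 1 = 1"
  using replace_umbrae_single[of h 0 1] by simp

lemma replace_umbrae_prod: "replace_umbrae h (\<Prod>x\<in>F. p x) = (\<Prod>x\<in>F. replace_umbrae h (p x))"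
  by (induction F rule: infinite_finite_induct) (simp_all add: replace_umbrae_mult)

lemma umbrae_replace_umbrae:
  fixes p :: "('a, 'b::comm_ring_1) umbral_poly"
  shows "umbrae (replace_umbrae h p) \<subseteq> h ` umbrae p"
proof -
  let ?q = "\<lambda>t. \<Prod>\<alpha>\<in>Poly_Mapping.keys t. umb (h \<alpha>) ^ Poly_Mapping.lookup t \<alpha> :: ('a, 'b) umbral_poly"
  have q: "umbrae (scal c * ?q t) \<subseteq> h ` Poly_Mapping.keys t" for c t
  proof
    fix \<beta> assume "\<beta> \<in> umbrae (scal c * ?q t)"
    moreover have "umbrae (scal c :: ('a, 'b) umbral_poly) = {}"
      unfolding umbrae_def scal_def by auto
    ultimately have "\<beta> \<in> umbrae (?q t)"
      using subsetD[OF umbrae_mult] by (metis Un_empty_left)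
    then obtain \<alpha> where "\<alpha> \<in> Poly_Mapping.keys t"
      "\<beta> \<in> umbrae (umb (h \<alpha>) ^ Poly_Mapping.lookup t \<alpha> :: ('a, 'b) umbral_poly)"
      using subsetD[OF umbrae_prod] by (metis (no_types, lifting) UN_E)
    then show "\<beta> \<in> h ` Poly_Mapping.keys t"
      using subsetD[OF umbrae_umb_power] by fast
  qed
  show ?thesis
  proof
    fix \<beta> assume "\<beta> \<in> umbrae (replace_umbrae h p)"
    then obtain t where "t \<in> Poly_Mapping.keys p" "\<beta> \<in> umbrae (scal (Poly_Mapping.lookup p t) * ?q t)"
      unfolding replace_umbrae_def using subsetD[OF umbrae_sum] by (metis (no_types, lifting) UN_E)
    then show "\<beta> \<in> h ` umbrae p" using subsetD[OF q] unfolding umbrae_def by blast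
  qed
qed

section \<open>Evaluation of uncorrelated products\<close>

context umbral_calculus
begin

lemma E_0 [simp]: "E 0 = 0"
  using E_scal[of 0 0] by simp

lemma E_sum: "E (\<Sum>x\<in>F. p x) = (\<Sum>x\<in>F. E (p x))"
  by (induction F rule: infinite_finite_induct) (simp_all add: E_add)

lemma E_power_product_inj:
  assumes "finite F" "inj_on g F"
  shows "E (\<Prod>x\<in>F. umb (g x) ^ i x) = (\<Prod>x\<in>F. E (umb (g x) ^ i x))"
proof -
  let ?i = "\<lambda>\<alpha>. i (inv_into F g \<alpha>)"
  have "(\<Prod>x\<in>F. umb (g x) ^ i x) = (\<Prod>\<alpha>\<in>g ` F. umb \<alpha> ^ ?i \<alpha> :: ('a, 'k) umbral_poly)"
    using assms(2) by (simp add: prod.reindex)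
  moreover have "(\<Prod>x\<in>F. E (umb (g x) ^ i x)) = (\<Prod>\<alpha>\<in>g ` F. E (umb \<alpha> ^ ?i \<alpha>))"
    using assms(2) by (simp add: prod.reindex)
  ultimately show ?thesis using E_power_product[of "g ` F" ?i] assms(1) by simp
qed

lemma E_single:
  "E (Poly_Mapping.single t c) = c * (\<Prod>\<alpha>\<in>Poly_Mapping.keys t. E (umb \<alpha> ^ Poly_Mapping.lookup t \<alpha>))"
proof -
  have "E (Poly_Mapping.single t c) = c * E (Poly_Mapping.single t 1)"
    by (simp only: single_eq_scal_mult[of t c] E_scal)
  also have "E (Poly_Mapping.single t 1) =
      (\<Prod>\<alpha>\<in>Poly_Mapping.keys t. E (umb \<alpha> ^ Poly_Mapping.lookup t \<alpha>))"
    by (simp only: single_eq_prod_umb[OF finite_keys subset_refl] E_power_product[OF finite_keys])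
  finally show ?thesis .
qed

text \<open>
  Evaluation only depends on the moments of the umbrae, provided that distinct umbrae remain
  distinct.
\<close>

lemma E_replace_umbrae:
  assumes "inj h" "\<And>\<alpha> j. E (umb (h \<alpha>) ^ j) = E (umb \<alpha> ^ j)"
  shows "E (replace_umbrae h p) = E p"
proof -
  have inj: "inj_on h A" for A using assms(1) by (rule inj_on_subset) simp
  have "E (replace_umbrae h p) =
      (\<Sum>t\<in>Poly_Mapping.keys p. E (Poly_Mapping.single t (Poly_Mapping.lookup p t)))"
    by (simp add: replace_umbrae_def E_sum E_scal E_power_product_inj[OF finite_keys inj] assms(2) E_single)
  also have "\<dots> = E p" by (simp add: E_sum[symmetric] sum_single_keys)
  finally show ?thesis .
qed

lemma E_single_add:
  assumes "Poly_Mapping.keys t \<inter> Poly_Mapping.keys u = {}"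
  shows "E (Poly_Mapping.single (t + u) (c * d)) =
    E (Poly_Mapping.single t c) * E (Poly_Mapping.single u d)"
proof -
  let ?e = "\<lambda>v A. \<Prod>\<alpha>\<in>A. E (umb \<alpha> ^ Poly_Mapping.lookup v \<alpha>)"
  let ?t = "Poly_Mapping.keys t" and ?u = "Poly_Mapping.keys u"
  have "?e (t + u) (Poly_Mapping.keys (t + u)) = ?e (t + u) (?t \<union> ?u)"
    using keys_add[of t u] by (intro prod.mono_neutral_left) (auto simp: in_keys_iff E_one)
  also have "\<dots> = ?e (t + u) ?t * ?e (t + u) ?u"
    using assms by (intro prod.union_disjoint) auto
  also have "?e (t + u) ?t = ?e t ?t"
  proof (rule prod.cong[OF refl])
    fix \<alpha> assume "\<alpha> \<in> ?t"
    then have "\<alpha> \<notin> ?u" using assms by blast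
    then show "E (umb \<alpha> ^ Poly_Mapping.lookup (t + u) \<alpha>) = E (umb \<alpha> ^ Poly_Mapping.lookup t \<alpha>)"
      by (simp add: lookup_add in_keys_iff)
  qed
  also have "?e (t + u) ?u = ?e u ?u"
  proof (rule prod.cong[OF refl])
    fix \<alpha> assume "\<alpha> \<in> ?u"
    then have "\<alpha> \<notin> ?t" using assms by blast
    then show "E (umb \<alpha> ^ Poly_Mapping.lookup (t + u) \<alpha>) = E (umb \<alpha> ^ Poly_Mapping.lookup u \<alpha>)"
      by (simp add: lookup_add in_keys_iff)
  qed
  finally show ?thesis by (simp only: E_single mult_ac)
qed

lemma E_mult_uncorrelated:
  assumes "uncorrelated p q"
  shows "E (p * q) = E p * E q"
proof -
  let ?s = "\<lambda>p t. Poly_Mapping.single t (Poly_Mapping.lookup p t)"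
  let ?P = "\<Sum>t\<in>Poly_Mapping.keys p. ?s p t" and ?Q = "\<Sum>u\<in>Poly_Mapping.keys q. ?s q u"
  have "Poly_Mapping.keys t \<inter> Poly_Mapping.keys u = {}"
    if "t \<in> Poly_Mapping.keys p" "u \<in> Poly_Mapping.keys q" for t u
    using assms that unfolding uncorrelated_def umbrae_def by blast
  then have "E (?P * ?Q) = E ?P * E ?Q"
    unfolding sum_product E_sum mult_single by (intro sum.cong refl E_single_add)
  then show ?thesis unfolding sum_single_keys .
qed

lemma E_prod_uncorrelated:
  assumes "finite F" "\<And>x y. x \<in> F \<Longrightarrow> y \<in> F \<Longrightarrow> x \<noteq> y \<Longrightarrow> uncorrelated (p x) (p y)"
  shows "E (\<Prod>x\<in>F. p x) = (\<Prod>x\<in>F. E (p x))"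
  using assms
proof (induction F)
  case empty
  then show ?case by (simp add: E_one)
next
  case (insert x F)
  have "umbrae (p x) \<inter> umbrae (p y) = {}" if "y \<in> F" for y
    using insert.prems[of x y] insert.hyps that unfolding uncorrelated_def by auto
  then have "uncorrelated (p x) (\<Prod>y\<in>F. p y)"
    using umbrae_prod[of p F] unfolding uncorrelated_def by blast
  then show ?case using insert by (simp add: E_mult_uncorrelated)
qed

end

section \<open>Evaluation of dot products\<close>

locale umbral_copying = umbral_calculus E for E :: "('a, 'k::field_char_0) umbral_poly \<Rightarrow> 'k" +
  fixes copy :: "nat \<Rightarrow> 'a \<Rightarrow> 'a"
  assumes copies: "umbral_copies E copy"
begin

lemma E_copy: "E (replace_umbrae (copy j) p) = E p"
proof (rule E_replace_umbrae)
  show "inj (copy j)"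
    using copies unfolding umbral_copies_def inj_def by auto
  show "E (umb (copy j \<alpha>) ^ i) = E (umb \<alpha> ^ i)" for \<alpha> i
    using copies unfolding umbral_copies_def similar_def by auto
qed

lemma uncorrelated_copies:
  assumes "i \<noteq> j"
  shows "uncorrelated (replace_umbrae (copy i) p) (replace_umbrae (copy j) q)"
proof -
  have "copy i \<alpha> \<noteq> copy j \<beta>" for \<alpha> \<beta>
    using copies assms unfolding umbral_copies_def inj_def by auto
  then show ?thesis
    using umbrae_replace_umbrae[of "copy i" p] umbrae_replace_umbrae[of "copy j" q]
    unfolding uncorrelated_def by blast
qed

text \<open>
  Along an injection the factors live on different copies, hence are uncorrelated, so every injection
  contributes the same product of evaluations.
\<close>

lemma E_injective_sum_copies:
  assumes "finite P"
  shows "E (injective_sum {1..n} P (\<lambda>b j. replace_umbrae (copy j) (p b))) =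
    falling (of_nat n) (card P) * (\<Prod>b\<in>P. E (p b))"
proof -
  have "E (\<Prod>b\<in>P. replace_umbrae (copy (f b)) (p b)) = (\<Prod>b\<in>P. E (p b))" if "inj_on f P" for f
    using assms that
    by (subst E_prod_uncorrelated) (auto intro!: uncorrelated_copies dest: inj_onD simp: E_copy)
  then have "E (injective_sum {1..n} P (\<lambda>b j. replace_umbrae (copy j) (p b))) =
      (\<Sum>f | f \<in> P \<rightarrow>\<^sub>E {1..n} \<and> inj_on f P. \<Prod>b\<in>P. E (p b))"
    by (simp add: injective_sum_def E_sum)
  also have "\<dots> = falling (of_nat n) (card P) * (\<Prod>b\<in>P. E (p b))"
    using card_injections[of "{1..n}" P, where 'r = 'k] assms by simp
  finally show ?thesis .
qed

lemma E_prod_dot: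
  assumes "finite I"
  shows "E (\<Prod>i\<in>I. dot copy n (p i)) =
    (\<Sum>\<pi> | partition_on I \<pi>. falling (of_nat n) (card \<pi>) * (\<Prod>B\<in>\<pi>. E (\<Prod>i\<in>B. p i)))"
  unfolding dot_def prod_sum_eq_partition_injective_sums[OF finite_atLeastAtMost assms] E_sum
    replace_umbrae_prod[symmetric]
  by (intro sum.cong refl E_injective_sum_copies) (use finite_elements[OF assms] in simp)

text \<open>
  The arbitrary indexing \<open>p\<close> of the factors, instead of a multiset, lets the same expansion serve
  both for \<open>M\<close> and for the powers of $\chi$ that define $\chi.\chi$.
\<close>

lemma dot_poly_eq:
  assumes "finite I" and M: "\<And>n. dot_mset copy n M = (\<Prod>i\<in>I. dot copy n (p i))"
  shows "dot_poly E copy M =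
    (\<Sum>\<pi> | partition_on I \<pi>. smult (\<Prod>B\<in>\<pi>. E (\<Prod>i\<in>B. p i)) (falling [:0, 1:] (card \<pi>)))"
    (is "_ = ?q")
  unfolding dot_poly_def
proof (rule the_equality)
  show q: "\<forall>n. poly ?q (of_nat n) = E (dot_mset copy n M)"
    using assms by (simp add: E_prod_dot poly_sum poly_falling mult.commute)
  show "q = ?q" if "\<forall>n. poly q (of_nat n) = E (dot_mset copy n M)" for q
    using that q by (intro poly_eqI_of_nat) simp
qed

section \<open>Cumulants\<close>

lemma E_poly_singleton_umbra:
  assumes "singleton_umbra E \<chi>"
  shows "E (poly (map_poly scal q) (umb \<chi>)) = coeff q 0 + coeff q 1"
proof -
  have "degree (map_poly scal q) \<le> Suc (degree q)"
    by (intro degree_le) (simp add: coeff_map_poly coeff_eq_0)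
  then have "poly (map_poly scal q) (umb \<chi>) = (\<Sum>i\<le>Suc (degree q). scal (coeff q i) * umb \<chi> ^ i)"
    unfolding poly_altdef
    by (intro sum.mono_neutral_cong_left) (auto simp: coeff_map_poly intro: le_degree)
  then have "E (poly (map_poly scal q) (umb \<chi>)) = (\<Sum>i\<le>Suc (degree q). coeff q i * E (umb \<chi> ^ i))"
    by (simp only: E_sum E_scal)
  also have "\<dots> = (\<Sum>i\<in>{0, 1}. coeff q i * E (umb \<chi> ^ i))"
    using assms unfolding singleton_umbra_def by (intro sum.mono_neutral_right) auto
  finally show ?thesis using assms by (simp add: singleton_umbra_def E_one)
qed

text \<open>
  Substituting $\chi$ for $n$ in the expansion of $E[(n.\mu)_M]$ replaces $(n)_{|\pi|}$ by
  $E[(\chi)_{|\pi|}]$. This is the classical formula for cumulants in terms of moments.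
\<close>

lemma E_chi_dot_mset:
  assumes "singleton_umbra E \<chi>" "finite I"
    and "\<And>n. dot_mset copy n M = (\<Prod>i\<in>I. dot copy n (p i))"
  shows "E (chi_dot_mset E copy \<chi> M) =
    (\<Sum>\<pi> | partition_on I \<pi>. signed_cycle_count (card \<pi>) * (\<Prod>B\<in>\<pi>. E (\<Prod>i\<in>B. p i)))"
  unfolding chi_dot_mset_def E_poly_singleton_umbra[OF assms(1)] dot_poly_eq[OF assms(2,3)]
  by (simp add: coeff_sum sum.distrib[symmetric] distrib_left[symmetric] low_coeffs_falling[simplified] mult.commute)

text \<open>
  In the expansion of $(\chi.\chi)^m$ only the partition into singletons survives, since a block with
  at least two elements contributes a vanishing moment of $\chi$.
\<close>

lemma moments_chi_dot_chi:
  assumes \<chi>: "singleton_umbra E \<chi>" and \<kappa>: "chi_dot_chi_umbra E copy \<chi> \<kappa>"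
  shows "E (umb \<kappa> ^ m) = signed_cycle_count m"
proof -
  let ?S = "(\<lambda>x. {x}) ` {..<m}"
  have mom: "E (\<Prod>i\<in>B. umb \<chi>) = (if card B = 1 then 1 else 0)" if "card B > 0" for B :: "nat set"
    using \<chi> that by (auto simp: singleton_umbra_def)
  have other: "(\<Prod>B\<in>\<pi>. E (\<Prod>i\<in>B. umb \<chi>)) = 0" if \<pi>: "partition_on {..<m} \<pi>" "\<pi> \<noteq> ?S" for \<pi>
  proof -
    have fin: "finite \<pi>" using finite_elements[OF _ \<pi>(1)] by simp
    have pos: "card B > 0" if "B \<in> \<pi>" for B
      using that \<pi>(1) finite_subset[of B "{..<m}"] unfolding partition_on_def
      by (auto simp: card_gt_0_iff)
    have "\<exists>B\<in>\<pi>. card B \<noteq> 1"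
    proof (rule ccontr)
      assume "\<not> ?thesis"
      then have "\<forall>B\<in>\<pi>. \<exists>x. B = {x}" by (auto simp: card_1_singleton_iff)
      then have "\<pi> = (\<lambda>x. {x}) ` \<Union>\<pi>" by fastforce
      then show False using \<pi> partition_onD1 by metis
    qed
    then show ?thesis using fin pos mom by (intro prod_zero) auto
  qed
  have "E (umb \<kappa> ^ m) = E (chi_dot_mset E copy \<chi> (replicate_mset m (umb \<chi>)))"
    using \<kappa> by (simp add: chi_dot_chi_umbra_def)
  also have "\<dots> = (\<Sum>\<pi> | partition_on {..<m} \<pi>. signed_cycle_count (card \<pi>) * (\<Prod>B\<in>\<pi>. E (\<Prod>i\<in>B. umb \<chi>)))"
    by (rule E_chi_dot_mset[OF \<chi>]) (auto simp: dot_mset_def)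
  also have "\<dots> = (\<Sum>\<pi>\<in>{?S}. signed_cycle_count (card \<pi>) * (\<Prod>B\<in>\<pi>. E (\<Prod>i\<in>B. umb \<chi>)))"
    using other finitely_many_partition_on[of "{..<m}"] partition_on_singletons[of "{..<m}"]
    by (intro sum.mono_neutral_right) auto
  also have "\<dots> = signed_cycle_count m"
    using \<chi> by (simp add: card_image prod.reindex singleton_umbra_def)
  finally show ?thesis .
qed

text \<open>
  Because the blocks of \<open>\<pi>\<close> in \<open>C\<close> are disjoint, the \<open>j\<close>th copy of the monomial of \<open>\<Union>C\<close>
  factors over these blocks. The subdivision is thereby a product of power sums in the copies of the
  block monomials.
\<close>

lemma dot_subdivision_eq:
  assumes "partition_on I \<pi>" "partition_on \<pi> \<tau>" "finite I"
  shows "dot_subdivision copy n (subdivision s \<tau>) =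
    (\<Prod>C\<in>\<tau>. \<Sum>j = 1..n. \<Prod>B\<in>C. replace_umbrae (copy j) (\<Prod>i\<in>B. s i))"
proof -
  have "dot_subdivision copy n (subdivision s \<tau>) = (\<Prod>C\<in>\<tau>. dot copy n (\<Prod>i\<in>\<Union>C. s i))"
    by (simp add: dot_subdivision_def subdivision_def image_mset.compositionality comp_def
        prod_unfold_prod_mset)
  also have "\<dots> = (\<Prod>C\<in>\<tau>. \<Sum>j = 1..n. \<Prod>B\<in>C. replace_umbrae (copy j) (\<Prod>i\<in>B. s i))"
  proof (rule prod.cong[OF refl])
    fix C assume "C \<in> \<tau>"
    then have C: "C \<subseteq> \<pi>" using partition_onD1[OF assms(2)] by auto
    have "(\<Prod>i\<in>\<Union>C. s i) = (\<Prod>B\<in>C. \<Prod>i\<in>B. s i)"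
    proof (subst prod.Union_disjoint)
      show "\<forall>A\<in>C. finite A"
        using C partition_onD1[OF assms(1)] assms(3) by (meson Sup_upper finite_subset subsetD)
      show "\<forall>A\<in>C. \<forall>B\<in>C. A \<noteq> B \<longrightarrow> A \<inter> B = {}"
        using C partition_onD2[OF assms(1)] unfolding pairwise_def disjnt_def by blast
    qed simp
    then show "dot copy n (\<Prod>i\<in>\<Union>C. s i) = (\<Sum>j = 1..n. \<Prod>B\<in>C. replace_umbrae (copy j) (\<Prod>i\<in>B. s i))"
      by (simp add: dot_def replace_umbrae_prod)
  qed
  finally show ?thesis .
qed

text \<open>
  The signed sum over \<open>\<tau>\<close> is the power sum expansion of an injective sum, taken in the polynomial
  ring before evaluation. The summands in which two blocks share a copy cancel, and what is left
  evaluates to $(n)_{|\pi|}$ times the product of the block moments.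
\<close>

lemma signed_sum_dot_subdivisions:
  assumes "partition_on I \<pi>" "finite I"
  shows "(\<Sum>\<tau> | partition_on \<pi> \<tau>.
      (\<Prod>C\<in>\<tau>. signed_cycle_count (card C)) * E (dot_subdivision copy n (subdivision s \<tau>))) =
    falling (of_nat n) (card \<pi>) * (\<Prod>B\<in>\<pi>. E (\<Prod>i\<in>B. s i))"
proof -
  have fin: "finite \<pi>" using finite_elements[OF assms(2,1)] .
  have "(\<Sum>\<tau> | partition_on \<pi> \<tau>.
      (\<Prod>C\<in>\<tau>. signed_cycle_count (card C)) * E (dot_subdivision copy n (subdivision s \<tau>))) =
    E (\<Sum>\<tau> | partition_on \<pi> \<tau>. scal (\<Prod>C\<in>\<tau>. signed_cycle_count (card C)) *
        (\<Prod>C\<in>\<tau>. \<Sum>j = 1..n. \<Prod>B\<in>C. replace_umbrae (copy j) (\<Prod>i\<in>B. s i)))"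
    unfolding E_sum E_scal
    by (intro sum.cong refl) (simp add: dot_subdivision_eq[OF assms(1) _ assms(2)])
  also have "\<dots> = E (injective_sum {1..n} \<pi> (\<lambda>B j. replace_umbrae (copy j) (\<Prod>i\<in>B. s i)))"
    using fin by (simp add: injective_sum_eq_power_sums scal_prod scal_signed_cycle_count prod.distrib)
  also have "\<dots> = falling (of_nat n) (card \<pi>) * (\<Prod>B\<in>\<pi>. E (\<Prod>i\<in>B. s i))"
    by (rule E_injective_sum_copies[OF fin])
  finally show ?thesis .
qed

end

lemma dot_mset_eq_prod:
  assumes "finite I" "s \<in> I \<rightarrow> set_mset M"
    and "\<And>\<mu>. \<mu> \<in># M \<Longrightarrow> card {i \<in> I. s i = \<mu>} = count M \<mu>"
  shows "dot_mset copy n M = (\<Prod>i\<in>I. dot copy n (s i))"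
proof -
  have "(\<Prod>i\<in>I. dot copy n (s i)) = (\<Prod>\<mu>\<in>set_mset M. \<Prod>i\<in>{i\<in>I. s i = \<mu>}. dot copy n (s i))"
    using assms(1,2) by (subst prod.group) auto
  also have "\<dots> = (\<Prod>\<mu>\<in>set_mset M. dot copy n \<mu> ^ card {i\<in>I. s i = \<mu>})"
    by (rule prod.cong) auto
  finally show ?thesis using assms(3) by (simp add: dot_mset_def)
qed

section \<open>The estimator of multivariate cumulants\<close>

theorem theorem6p2:
  fixes E :: "('a, 'k::field_char_0) umbral_poly \<Rightarrow> 'k"
    and copy :: "nat \<Rightarrow> 'a \<Rightarrow> 'a"
    and \<chi> \<kappa> :: 'a
    and \<kappa>s :: "nat set set set \<Rightarrow> nat set set \<Rightarrow> 'a"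
    and M :: "('a, 'k) umbral_poly multiset"
    and s :: "nat \<Rightarrow> ('a, 'k) umbral_poly"
    and k n :: nat
  assumes "umbral_calculus E"
    and "umbral_copies E copy"
    and "singleton_umbra E \<chi>"
    and "\<And>\<mu>. \<mu> \<in># M \<Longrightarrow> umbral_monomial \<mu>"
    and "\<And>\<mu>. \<mu> \<in># M \<Longrightarrow> \<chi> \<notin> umbrae \<mu>"
    and "size M = k"
    and "n > k"
    and "s \<in> {1..k} \<rightarrow> set_mset M"
    and "\<And>\<mu>. \<mu> \<in># M \<Longrightarrow> card {j \<in> {1..k}. s j = \<mu>} = count M \<mu>"
    and "chi_dot_chi_umbra E copy \<chi> \<kappa>"
    and "\<And>\<pi> \<tau>. partition_on {1..k} \<pi> \<Longrightarrow> partition_on \<pi> \<tau> \<Longrightarrow>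
           inj_on (\<kappa>s \<tau>) \<tau> \<and> (\<forall>C\<in>\<tau>. similar E (umb (\<kappa>s \<tau> C)) (umb \<kappa>))"
    and "\<And>\<pi> \<tau>. partition_on {1..k} \<pi> \<Longrightarrow> partition_on \<pi> \<tau> \<Longrightarrow>
           uncorrelated (umb \<kappa> ^ card \<pi> :: ('a, 'k) umbral_poly) (dot_power_partition (\<kappa>s \<tau>) \<tau>) \<and>
           uncorrelated (umb \<kappa> ^ card \<pi>) (dot_subdivision copy n (subdivision s \<tau>)) \<and>
           uncorrelated (dot_power_partition (\<kappa>s \<tau>) \<tau>) (dot_subdivision copy n (subdivision s \<tau>))"
  shows "umb_equiv E (chi_dot_mset E copy \<chi> M)
     (\<Sum>\<pi> | partition_on {1..k} \<pi>.
        scal (1 / falling (of_nat n) (card \<pi>)) * umb \<kappa> ^ card \<pi> *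
        (\<Sum>\<tau> | partition_on \<pi> \<tau>.
           dot_power_partition (\<kappa>s \<tau>) \<tau> * dot_subdivision copy n (subdivision s \<tau>)))"
proof -
  interpret umbral_copying E copy
    using assms(1,2) by (simp add: umbral_copying_def umbral_copying_axioms_def)
  note \<kappa> = moments_chi_dot_chi[OF assms(3,10)]
  let ?m = "\<lambda>\<pi>. \<Prod>B\<in>\<pi>. E (\<Prod>i\<in>B. s i)"
  \<comment> \<open>The two falling factorials cancel, so the formula holds summand by summand in \<open>\<pi>\<close>.\<close>
  have term_eq: "E (scal (1 / falling (of_nat n) (card \<pi>)) * umb \<kappa> ^ card \<pi> *
        (\<Sum>\<tau> | partition_on \<pi> \<tau>.
           dot_power_partition (\<kappa>s \<tau>) \<tau> * dot_subdivision copy n (subdivision s \<tau>))) =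
      signed_cycle_count (card \<pi>) * ?m \<pi>" if \<pi>: "partition_on {1..k} \<pi>" for \<pi>
  proof -
    have fin: "finite \<pi>" using finite_elements[OF _ \<pi>] by simp
    have "card \<pi> \<le> k" using card_partition_on_le[OF _ \<pi>] by simp
    \<comment> \<open>This is where \<open>n > k\<close> enters: all factors of the denominator are nonzero.\<close>
    then have nz: "falling (of_nat n) (card \<pi>) \<noteq> (0 :: 'k)"
      using assms(7) by (intro falling_of_nat_nonzero) simp
    have prod: "E (umb \<kappa> ^ card \<pi> *
          (dot_power_partition (\<kappa>s \<tau>) \<tau> * dot_subdivision copy n (subdivision s \<tau>))) =
        signed_cycle_count (card \<pi>) * ((\<Prod>C\<in>\<tau>. signed_cycle_count (card C)) *
          E (dot_subdivision copy n (subdivision s \<tau>)))" if \<tau>: "partition_on \<pi> \<tau>" for \<tau>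
    proof -
      let ?D = "dot_power_partition (\<kappa>s \<tau>) \<tau> :: ('a, 'k) umbral_poly"
        and ?S = "dot_subdivision copy n (subdivision s \<tau>)"
      have "finite \<tau>" using finite_elements[OF fin \<tau>] .
      then have "E ?D = (\<Prod>C\<in>\<tau>. E (umb (\<kappa>s \<tau> C) ^ card C))"
        using assms(11)[OF \<pi> \<tau>] by (simp add: dot_power_partition_def E_power_product_inj)
      also have "\<dots> = (\<Prod>C\<in>\<tau>. signed_cycle_count (card C))"
        using assms(11)[OF \<pi> \<tau>] by (simp add: similar_def \<kappa>)
      finally have D: "E ?D = (\<Prod>C\<in>\<tau>. signed_cycle_count (card C))" .
      have "uncorrelated (umb \<kappa> ^ card \<pi>) (?D * ?S)"
        using assms(12)[OF \<pi> \<tau>] umbrae_mult[of ?D ?S] unfolding uncorrelated_def by blast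
      then show ?thesis
        using assms(12)[OF \<pi> \<tau>] by (simp add: E_mult_uncorrelated \<kappa> D)
    qed
    have "E (scal (1 / falling (of_nat n) (card \<pi>)) * umb \<kappa> ^ card \<pi> *
        (\<Sum>\<tau> | partition_on \<pi> \<tau>.
           dot_power_partition (\<kappa>s \<tau>) \<tau> * dot_subdivision copy n (subdivision s \<tau>))) =
      1 / falling (of_nat n) (card \<pi>) * (signed_cycle_count (card \<pi>) *
        (\<Sum>\<tau> | partition_on \<pi> \<tau>. (\<Prod>C\<in>\<tau>. signed_cycle_count (card C)) *
          E (dot_subdivision copy n (subdivision s \<tau>))))"
      by (simp only: mult.assoc E_scal) (simp add: sum_distrib_left E_sum prod)
    then show ?thesis
      using nz signed_sum_dot_subdivisions[OF \<pi>] by simp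
  qed
  have "E (chi_dot_mset E copy \<chi> M) = (\<Sum>\<pi> | partition_on {1..k} \<pi>. signed_cycle_count (card \<pi>) * ?m \<pi>)"
    using assms(3,8,9) by (intro E_chi_dot_mset dot_mset_eq_prod) auto
  then show ?thesis by (simp add: umb_equiv_def E_sum term_eq)
qed

end
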